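(* Let $k$ be a positive integer. Every graph $G$ of order $n\ge 6k-4$ with $\Delta(G)=2$ is $k$-placeable.
   Context: All graphs are finite and simple; $\Delta(G)$ is the maximum degree. For a graph $G$ on $n$ vertices, a $k$-placement of $G$ is a $k$-tuple $(\phi_1,\dots,\phi_k)$ of bijections $\phi_i:V(G)\to V(K_n)$ such that the edge sets $\phi_i(E(G))=\{\phi_i(x)\phi_i(y):xy\in E(G)\}$ are pairwise disjoint; $G$ is $k$-placeable if it has one. *)

theory Defs
  imports Main
begin

definition simple_graph :: "'a set \<Rightarrow> 'a set set \<Rightarrow> bool" where
  "simple_graph V E \<longleftrightarrow> finite V \<and> (\<forall>e\<in>E. e \<subseteq> V \<and> card e = 2)"

definition degree :: "'a set set \<Rightarrow> 'a \<Rightarrow> nat" where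
  "degree E v = card {e\<in>E. v \<in> e}"

definition max_degree :: "'a set \<Rightarrow> 'a set set \<Rightarrow> nat" where
  "max_degree V E = Max (degree E ` V)"

definition edge_image :: "('a \<Rightarrow> 'b) \<Rightarrow> 'a set set \<Rightarrow> 'b set set" where
  "edge_image f E = (\<lambda>e. f ` e) ` E"

text \<open>A k-placement: k bijections V \<rightarrow> V(K_n) = {0..<n}, with pairwise disjoint edge images.\<close>
definition placement :: "'a set \<Rightarrow> 'a set set \<Rightarrow> nat \<Rightarrow> (nat \<Rightarrow> 'a \<Rightarrow> nat) \<Rightarrow> bool" where
  "placement V E k \<phi> \<longleftrightarrow>
     (\<forall>i<k. bij_betw (\<phi> i) V {0..<card V}) \<and>
     (\<forall>i<k. \<forall>j<k. i \<noteq> j \<longrightarrow> edge_image (\<phi> i) E \<inter> edge_image (\<phi> j) E = {})"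

definition placeable :: "'a set \<Rightarrow> 'a set set \<Rightarrow> nat \<Rightarrow> bool" where
  "placeable V E k \<longleftrightarrow> (\<exists>\<phi>. placement V E k \<phi>)"

end

theory Submission
  imports Defs
begin

text \<open>
A graph of maximum degree at most two can be laid out on \<open>0, \<dots>, n - 1\<close> so that adjacent vertices are at
distance at most two. Hence it suffices to place \<open>k\<close> edge-disjoint copies of the square of
the path with \<open>n\<close> vertices in the complete graph on \<open>n\<close> vertices.

For \<open>m\<close> coprime to 6 arrange \<open>5 m\<close> positions in \<open>m\<close> rows of length 5 and let the \<open>i\<close>-th copy
rotate column \<open>c\<close> by \<open>(c - 2) i\<close> modulo \<open>m\<close>. Positions at distance at most two lie in different
columns, and the difference of their shifts is \<open>i\<close> times a unit, so the \<open>m\<close> copies are disjoint.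
A new vertex, fixed by all copies, may be inserted between two rows: its neighbours lie in
columns different from 2, where the shifts separate the copies. This gives
\<open>m\<close> copies whenever \<open>5 m \<le> n \<le> 6 m + 1\<close>, which covers all but finitely many \<open>n\<close>.

The remaining \<open>n > 8\<close> are handled by affine maps \<open>p \<mapsto> a p + b\<close> modulo some \<open>N\<close> close to \<open>n\<close>, with
multipliers \<open>a\<close> for which the sets \<open>{a, -a, 2 a, -2 a}\<close> are pairwise disjoint. For \<open>n = 8\<close> the square
of the path has no two disjoint copies; there the degree bound is used once more.
\<close>

section \<open>Layouts of bandwidth two\<close>

text \<open>Recursive from the head because layouts grow by prepending. Of the vertices after
  \<open>x\<close>, only the two skipped by \<open>drop 2 xs\<close> may be adjacent to it.\<close>

fun square_layout :: "('a \<Rightarrow> 'a \<Rightarrow> bool) \<Rightarrow> 'a list \<Rightarrow> bool" where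
  "square_layout R [] \<longleftrightarrow> True"
| "square_layout R (x # xs) \<longleftrightarrow> (\<forall>u\<in>set (drop 2 xs). \<not> R x u) \<and> square_layout R xs"

lemma square_layout_nth:
  assumes "square_layout R xs" "a < b" "b < length xs" "R (xs ! a) (xs ! b)"
  shows "b \<le> a + 2"
  using assms
proof (induction xs arbitrary: a b)
  case Nil
  then show ?case by simp
next
  case (Cons x xs)
  obtain b' where b: "b = Suc b'" using Cons.prems(2) by (cases b) auto
  show ?case
  proof (cases a)
    case 0
    show ?thesis
    proof (rule ccontr)
      assume "\<not> b \<le> a + 2"
      with 0 b have "2 \<le> b'" by simp
      then have "Suc (Suc (b' - 2)) = b'" by simp
      with \<open>2 \<le> b'\<close> Cons.prems(3) b have "drop 2 xs ! (b' - 2) = xs ! b'" "b' - 2 < length (drop 2 xs)"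
        by auto
      then have "xs ! b' \<in> set (drop 2 xs)" by (metis nth_mem)
      with Cons.prems(1,4) 0 b show False by auto
    qed
  next
    case (Suc a')
    with Cons.prems b Cons.IH[of a' b'] show ?thesis by auto
  qed
qed

text \<open>\<open>U v\<close> stands for the unplaced neighbours of \<open>v\<close>. Only the next
  prepended vertex comes within two positions of the second newest vertex \<open>y\<close>, and only
  the next two come that close to the newest vertex \<open>x\<close>; if \<open>x\<close> claims
  both, \<open>y\<close> must claim none.\<close>

fun frontier_ok :: "('a \<Rightarrow> 'a set) \<Rightarrow> 'a list \<Rightarrow> bool" where
  "frontier_ok U (x # y # _) \<longleftrightarrow> card (U y) \<le> 1 \<and> (card (U x) \<le> 1 \<or> U y = {})"
| "frontier_ok U _ \<longleftrightarrow> True"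

text \<open>The invariant of a greedy construction: all vertices but the two newest have every
  neighbour placed, and the demands of those two can still be met.\<close>

definition partial_layout :: "'a set \<Rightarrow> ('a \<Rightarrow> 'a \<Rightarrow> bool) \<Rightarrow> 'a list \<Rightarrow> bool" where
  "partial_layout V R xs \<longleftrightarrow> distinct xs \<and> set xs \<subseteq> V \<and> square_layout R xs \<and>
     (\<forall>v\<in>set (drop 2 xs). {u. R v u} \<subseteq> set xs) \<and> frontier_ok (\<lambda>v. {u. R v u} - set xs) xs"

context
  fixes V :: "'a set" and R :: "'a \<Rightarrow> 'a \<Rightarrow> bool"
  assumes fin: "finite V"
    and dom: "\<And>u v. R u v \<Longrightarrow> u \<in> V"
    and sym: "\<And>u v. R u v \<Longrightarrow> R v u"
    and deg: "\<And>v. v \<in> V \<Longrightarrow> card {u. R v u} \<le> 2"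
begin

lemma finite_nbrs [simp]: "finite {u. R v u}"
  by (rule finite_subset[OF _ fin]) (auto dest: sym dom)

text \<open>A vertex chosen because it is adjacent to a placed one has at most one neighbour left to
  place.\<close>

lemma card_nbrs_remove:
  assumes "v \<in> V" "R v u" "u \<in> A"
  shows "card ({u. R v u} - A) \<le> 1"
proof -
  have "card ({u. R v u} - A) \<le> card ({u. R v u} - {u})"
    using assms by (intro card_mono) auto
  also have "\<dots> \<le> 1" using assms deg[of v] by (simp add: card_Diff_singleton)
  finally show ?thesis .
qed

text \<open>Greedy choice: the unplaced neighbour of the second newest vertex if there is one,
  otherwise one of the newest vertex, otherwise any unplaced vertex. In the first two cases the
  choice has a placed neighbour, so its own demand is at most one; in the third nothing else is
  demanded.\<close>

lemma partial_layout_extend: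
  assumes xs: "partial_layout V R xs" and sub: "set xs \<subset> V"
  shows "\<exists>w. partial_layout V R (w # xs)"
proof -
  define U where "U v = {u. R v u} - set xs" for v
  have d: "distinct xs" "set xs \<subseteq> V" "square_layout R xs"
    and cl: "\<And>v u. v \<in> set (drop 2 xs) \<Longrightarrow> R v u \<Longrightarrow> u \<in> set xs"
    and fr: "frontier_ok U xs"
    using xs unfolding partial_layout_def U_def by auto
  have UV: "U v \<subseteq> V - set xs" for v unfolding U_def using sym dom by blast
  obtain w0 where w0: "w0 \<in> V - set xs" using sub by auto
  \<comment> \<open>At most one vertex leaves the frontier, and by \<open>c\<close> it waits for
    nothing but \<open>w\<close>. Vertices behind the frontier have all neighbours placed, so none
    is adjacent to \<open>w\<close>.\<close>
  have step: "partial_layout V R (w # xs)"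
    if w: "w \<in> V - set xs"
      and c: "\<And>v. v \<in> set (drop 2 (w # xs)) \<Longrightarrow> v \<notin> set (drop 2 xs) \<Longrightarrow> U v \<subseteq> {w}"
      and f: "frontier_ok (\<lambda>v. {u. R v u} - set (w # xs)) (w # xs)" for w
  proof -
    have "{u. R v u} \<subseteq> set (w # xs)" if "v \<in> set (drop 2 (w # xs))" for v
      using c[OF that] cl[of v] unfolding U_def by auto
    moreover have "\<not> R w u" if "u \<in> set (drop 2 xs)" for u
      using cl[OF that, of w] w sym[of w u] by auto
    ultimately show ?thesis unfolding partial_layout_def using w d f by auto
  qed
  show ?thesis
  proof (cases xs)
    case Nil
    have "partial_layout V R (w0 # xs)" by (rule step[OF w0]) (simp_all add: Nil)
    then show ?thesis by blast
  next
    case (Cons x xs')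
    then have x: "x \<in> V" using d by auto
    have Ux: "card (U x) \<le> 2"
      using deg[OF x] card_mono[of "{u. R x u}" "U x"] unfolding U_def by fastforce
    \<comment> \<open>Once no unplaced vertex is adjacent to the second newest one, the newest one may still
      have two unplaced neighbours: placing one of them leaves one for each frontier vertex.\<close>
    have fresh: "\<exists>w. w \<in> V - set xs \<and> card (U x - {w}) \<le> 1 \<and>
        (card ({u. R w u} - set (w # xs)) \<le> 1 \<or> U x - {w} = {})"
    proof (cases "U x = {}")
      case True
      then show ?thesis using w0 by auto
    next
      case False
      then obtain w where w: "w \<in> U x" by auto
      then have "card (U x - {w}) \<le> 1" using Ux by simp
      moreover have "card ({u. R w u} - set (w # xs)) \<le> 1"
        using w UV[of x] by (intro card_nbrs_remove[of _ x]) (auto simp: U_def Cons intro: sym)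
      ultimately show ?thesis using w UV[of x] by blast
    qed
    have Udiff: "{u. R v u} - set (w # xs) = U v - {w}" for v w unfolding U_def by auto
    show ?thesis
    proof (cases xs')
      case Nil
      from fresh obtain w where w: "w \<in> V - set xs" "card (U x - {w}) \<le> 1"
        "card ({u. R w u} - set (w # xs)) \<le> 1 \<or> U x - {w} = {}" by blast
      have "partial_layout V R (w # xs)"
        by (rule step[OF w(1)]) (use w Cons Nil Udiff in auto)
      then show ?thesis by blast
    next
      case (Cons y ys)
      note xs_eq = \<open>xs = x # xs'\<close>[unfolded Cons]
      have y: "y \<in> V" using d xs_eq by auto
      have fr': "card (U y) \<le> 1" "card (U x) \<le> 1 \<or> U y = {}" using fr xs_eq by auto
      have frw: "frontier_ok (\<lambda>v. {u. R v u} - set (w # xs)) (w # xs) \<longleftrightarrow>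
          card (U x - {w}) \<le> 1 \<and> (card ({u. R w u} - set (w # xs)) \<le> 1 \<or> U x - {w} = {})" for w
        unfolding Udiff by (simp add: xs_eq)
      have dr: "v = y" if "v \<in> set (drop 2 (w # xs))" "v \<notin> set (drop 2 xs)" for v w
        using that by (auto simp: xs_eq)
      show ?thesis
      proof (cases "U y = {}")
        case True
        from fresh obtain w where w: "w \<in> V - set xs" "card (U x - {w}) \<le> 1"
          "card ({u. R w u} - set (w # xs)) \<le> 1 \<or> U x - {w} = {}" by blast
        have "partial_layout V R (w # xs)"
          by (rule step[OF w(1)]) (use w dr True frw in auto)
        then show ?thesis by blast
      next
        case False
        then obtain w where w: "U y = {w}"
          using fr'(1) by (metis One_nat_def U_def card_1_singletonE card_0_eq finite_Diff
              finite_nbrs le_SucE le_zero_eq)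
        have wV: "w \<in> V - set xs" using w UV[of y] by auto
        have "card ({u. R w u} - set (w # xs)) \<le> 1"
          using w wV by (intro card_nbrs_remove[of _ y]) (auto simp: U_def xs_eq intro: sym)
        moreover have "card (U x - {w}) \<le> 1"
          using fr'(2) False card_mono[of "U x" "U x - {w}"] unfolding U_def by fastforce
        ultimately have "partial_layout V R (w # xs)"
          by (intro step[OF wV]) (use w dr frw in auto)
        then show ?thesis by blast
      qed
    qed
  qed
qed

lemma ex_square_layout: "\<exists>xs. distinct xs \<and> set xs = V \<and> square_layout R xs"
proof -
  have "\<exists>xs. partial_layout V R xs \<and> length xs = l" if "l \<le> card V" for l
    using that
  proof (induction l)
    case 0
    show ?case by (auto simp: partial_layout_def)
  next
    case (Suc l)
    then obtain xs where xs: "partial_layout V R xs" "length xs = l" by auto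
    then have "card (set xs) < card V" "set xs \<subseteq> V"
      using Suc.prems by (auto simp: partial_layout_def distinct_card)
    then have "set xs \<subset> V" by auto
    from partial_layout_extend[OF xs(1) this] xs(2) show ?case by (metis length_Cons)
  qed
  then obtain xs where xs: "partial_layout V R xs" "length xs = card V" by blast
  then have "set xs = V"
    by (metis card_subset_eq distinct_card fin partial_layout_def)
  with xs show ?thesis unfolding partial_layout_def by blast
qed

end

lemma graph_layout:
  assumes g: "simple_graph V E" and d: "\<And>v. v \<in> V \<Longrightarrow> degree E v \<le> 2"
  shows "\<exists>f. bij_betw f V {..<card V} \<and>
    (\<forall>e\<in>E. \<exists>u v. e = {u, v} \<and> u \<in> V \<and> v \<in> V \<and> f u < f v \<and> f v \<le> f u + 2)"
proof -
  define R where "R u v \<longleftrightarrow> {u, v} \<in> E" for u v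
  have fin: "finite V" and E: "\<And>e. e \<in> E \<Longrightarrow> e \<subseteq> V \<and> card e = 2"
    using g unfolding simple_graph_def by auto
  have finE: "finite E" by (rule finite_subset[of _ "Pow V"]) (use fin E in auto)
  have dom: "u \<in> V" if "R u v" for u v using E that unfolding R_def by auto
  have sym: "R v u" if "R u v" for u v using that unfolding R_def by (simp add: insert_commute)
  have deg: "card {u. R v u} \<le> 2" if "v \<in> V" for v
  proof -
    have "inj_on (\<lambda>u. {v, u}) {u. R v u}" by (rule inj_onI) (auto simp: doubleton_eq_iff)
    then have "card {u. R v u} \<le> card {e\<in>E. v \<in> e}"
      by (rule card_inj_on_le) (auto simp: R_def finE)
    with d[OF that] show ?thesis unfolding degree_def by simp
  qed
  obtain xs where xs: "distinct xs" "set xs = V" "square_layout R xs"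
    using ex_square_layout[of V R] fin dom sym deg by metis
  have len: "length xs = card V" using xs by (metis distinct_card)
  have b: "bij_betw ((!) xs) {..<card V} V" using bij_betw_nth[OF xs(1)] xs(2) len by simp
  define f where "f = the_inv_into {..<card V} ((!) xs)"
  have f: "bij_betw f V {..<card V}" unfolding f_def by (rule bij_betw_the_inv_into[OF b])
  have xf: "xs ! f v = v" if "v \<in> V" for v
    unfolding f_def by (rule f_the_inv_into_f_bij_betw[OF b]) (use that in simp)
  have fl: "f v < length xs" if "v \<in> V" for v
    using f that len bij_betw_apply by fastforce
  have "\<exists>u v. e = {u, v} \<and> u \<in> V \<and> v \<in> V \<and> f u < f v \<and> f v \<le> f u + 2" if e: "e \<in> E" for e
  proof -
    obtain a b where ab: "e = {a, b}" "a \<noteq> b" using E[OF e] by (meson card_2_iff)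
    then have V: "a \<in> V" "b \<in> V" using E[OF e] by auto
    have "f a \<noteq> f b" using xf V ab(2) by metis
    then consider "f a < f b" | "f b < f a" by linarith
    then show ?thesis
    proof cases
      case 1
      have "R a b" using e ab R_def by simp
      then have "f b \<le> f a + 2"
        using square_layout_nth[OF xs(3) 1 fl[OF V(2)]] xf V by simp
      with 1 V ab show ?thesis by blast
    next
      case 2
      have "R b a" using e ab R_def by (simp add: insert_commute)
      then have "f a \<le> f b + 2"
        using square_layout_nth[OF xs(3) 2 fl[OF V(1)]] xf V by simp
      with 2 V ab show ?thesis by (metis insert_commute)
    qed
  qed
  with f show ?thesis by blast
qed

section \<open>Packing squares of paths\<close>

text \<open>The edges of the square of the path on \<open>0, ..., n - 1\<close>, each with its
  smaller end first.\<close>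

definition square_edge :: "nat \<Rightarrow> nat \<Rightarrow> nat \<Rightarrow> bool" where
  "square_edge n p q \<longleftrightarrow> p < q \<and> q \<le> p + 2 \<and> q < n"

definition square_packing :: "nat \<Rightarrow> nat \<Rightarrow> (nat \<Rightarrow> nat \<Rightarrow> nat) \<Rightarrow> bool" where
  "square_packing k n \<phi> \<longleftrightarrow>
     (\<forall>i<k. bij_betw (\<phi> i) {..<n} {..<n}) \<and>
     (\<forall>i<k. \<forall>j<k. i \<noteq> j \<longrightarrow> (\<forall>p q p' q'. square_edge n p q \<longrightarrow> square_edge n p' q' \<longrightarrow>
        {\<phi> i p, \<phi> i q} \<noteq> {\<phi> j p', \<phi> j q'}))"

lemma bij_betw_lessThanI:
  fixes f :: "nat \<Rightarrow> nat"
  assumes "inj_on f {..<n}" "\<And>p. p < n \<Longrightarrow> f p < n"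
  shows "bij_betw f {..<n} {..<n}"
  unfolding bij_betw_def using assms endo_inj_surj[of "{..<n}" f] by auto

text \<open>The layout embeds the graph into the square of the path, and disjointness of copies
  passes to subgraphs.\<close>

lemma square_packing_placeable:
  assumes g: "simple_graph V E" and d: "\<And>v. v \<in> V \<Longrightarrow> degree E v \<le> 2"
    and p: "square_packing k (card V) \<phi>"
  shows "placeable V E k"
proof -
  obtain f where f: "bij_betw f V {..<card V}"
    and fE: "\<And>e. e \<in> E \<Longrightarrow> \<exists>u v. e = {u, v} \<and> u \<in> V \<and> v \<in> V \<and> f u < f v \<and> f v \<le> f u + 2"
    using graph_layout[OF g d] by blast
  have fe: "\<exists>p q. f ` e = {p, q} \<and> square_edge (card V) p q" if "e \<in> E" for e
    using fE[OF that] bij_betw_apply[OF f] unfolding square_edge_def by fastforce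
  have "placement V E k (\<lambda>i. \<phi> i \<circ> f)"
    unfolding placement_def
  proof (intro conjI allI impI)
    fix i assume "i < k"
    then show "bij_betw (\<phi> i \<circ> f) V {0..<card V}"
      using p f unfolding square_packing_def lessThan_atLeast0[symmetric]
      by (blast intro: bij_betw_trans)
  next
    fix i j assume ij: "i < k" "j < k" "i \<noteq> j"
    have "(\<phi> i \<circ> f) ` e \<noteq> (\<phi> j \<circ> f) ` e'" if e: "e \<in> E" "e' \<in> E" for e e'
    proof -
      obtain p q p' q' where "f ` e = {p, q}" "square_edge (card V) p q"
        "f ` e' = {p', q'}" "square_edge (card V) p' q'"
        using fe[OF e(1)] fe[OF e(2)] by blast
      moreover from this have "{\<phi> i p, \<phi> i q} \<noteq> {\<phi> j p', \<phi> j q'}"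
        using p ij unfolding square_packing_def by blast
      ultimately show ?thesis unfolding image_comp[symmetric] by simp
    qed
    then show "edge_image (\<phi> i \<circ> f) E \<inter> edge_image (\<phi> j \<circ> f) E = {}"
      unfolding edge_image_def disjoint_iff by (metis imageE)
  qed
  then show ?thesis unfolding placeable_def by blast
qed

lemma placeable_mono:
  assumes "placeable V E l" "k \<le> l"
  shows "placeable V E k"
proof -
  obtain \<phi> where "placement V E l \<phi>" using assms(1) unfolding placeable_def by blast
  then have "placement V E k \<phi>" using assms(2) unfolding placement_def by simp
  then show ?thesis unfolding placeable_def by blast
qed

section \<open>Inserting fixed vertices into a packing\<close>

text \<open>A new vertex inserted before position \<open>g\<close> gets the neighbours \<open>g - 2, \<dots>, g + 1\<close>; being fixed by all
copies, it needs the images of these to differ between copies.\<close>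

definition free_gap :: "nat \<Rightarrow> nat \<Rightarrow> (nat \<Rightarrow> nat \<Rightarrow> nat) \<Rightarrow> nat \<Rightarrow> bool" where
  "free_gap k n \<phi> g \<longleftrightarrow> g \<le> n \<and>
     (\<forall>i<k. \<forall>j<k. \<forall>p<n. \<forall>q<n. i \<noteq> j \<longrightarrow> g \<le> p + 2 \<longrightarrow> p < g + 2 \<longrightarrow> g \<le> q + 2 \<longrightarrow> q < g + 2 \<longrightarrow>
        \<phi> i p \<noteq> \<phi> j q)"

definition insert_fixed :: "nat \<Rightarrow> nat \<Rightarrow> (nat \<Rightarrow> nat \<Rightarrow> nat) \<Rightarrow> nat \<Rightarrow> nat \<Rightarrow> nat" where
  "insert_fixed g n \<phi> i p = (if p < g then \<phi> i p else if p = g then n else \<phi> i (p - 1))"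

text \<open>In every copy only position \<open>g\<close> is mapped to the new value
  \<open>n\<close>. Hence a common edge uses \<open>g\<close> in both copies, where
  \<open>free_gap\<close> separates the other ends, or in neither, where it would be common already
  in the old packing.\<close>

lemma square_packing_insert_fixed:
  assumes \<phi>: "square_packing k n \<phi>" and g: "free_gap k n \<phi> g"
  shows "square_packing k (Suc n) (insert_fixed g n \<phi>)"
proof -
  let ?\<psi> = "insert_fixed g n \<phi>"
  \<comment> \<open>The old position of \<open>p\<close>, meaningful for
    \<open>p \<noteq> g\<close>.\<close>
  define r where "r p = (if p < g then p else p - 1)" for p
  have gn: "g \<le> n" using g unfolding free_gap_def by simp
  have \<psi>: "?\<psi> i p = (if p = g then n else \<phi> i (r p))" for i p
    unfolding insert_fixed_def r_def by simp
  have r: "r p < n" if "p < Suc n" "p \<noteq> g" for p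
    using that gn unfolding r_def by auto
  have r_inj: "p = q" if "r p = r q" "p \<noteq> g" "q \<noteq> g" for p q
    using that unfolding r_def by (auto split: if_splits)
  have \<phi>n: "\<phi> i p < n" if "i < k" "p < n" for i p
    using \<phi> that bij_betw_apply unfolding square_packing_def by fastforce
  have \<phi>inj: "p = q" if "i < k" "p < n" "q < n" "\<phi> i p = \<phi> i q" for i p q
    using \<phi> that unfolding square_packing_def bij_betw_def inj_on_def by auto
  have \<psi>n: "?\<psi> i p = n \<longleftrightarrow> p = g" if "i < k" "p < Suc n" for i p
    using \<phi>n[OF that(1) r[OF that(2)]] unfolding \<psi> by auto
  show ?thesis
    unfolding square_packing_def
  proof (intro conjI allI impI)
    fix i assume i: "i < k"
    show "bij_betw (?\<psi> i) {..<Suc n} {..<Suc n}"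
    proof (rule bij_betw_lessThanI)
      show "inj_on (?\<psi> i) {..<Suc n}"
      proof (rule inj_onI)
        fix p q assume pq: "p \<in> {..<Suc n}" "q \<in> {..<Suc n}" "?\<psi> i p = ?\<psi> i q"
        show "p = q"
        proof (cases "p = g \<or> q = g")
          case True
          then show ?thesis using \<psi>n[OF i] pq by (metis lessThan_iff)
        next
          case False
          then have "r p = r q" using pq r \<phi>inj[OF i] unfolding \<psi> by simp
          with False r_inj show ?thesis by blast
        qed
      qed
      show "?\<psi> i p < Suc n" if "p < Suc n" for p
        unfolding \<psi> using r[OF that] \<phi>n[OF i] by (simp add: less_SucI)
    qed
  next
    fix i j p q p' q'
    assume ij: "i < k" "j < k" "i \<noteq> j" and e: "square_edge (Suc n) p q" "square_edge (Suc n) p' q'"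
    note eb = e[unfolded square_edge_def]
    show "{?\<psi> i p, ?\<psi> i q} \<noteq> {?\<psi> j p', ?\<psi> j q'}"
    proof
      assume eq: "{?\<psi> i p, ?\<psi> i q} = {?\<psi> j p', ?\<psi> j q'}"
      have "n \<in> {?\<psi> i p, ?\<psi> i q} \<longleftrightarrow> g = p \<or> g = q"
        using \<psi>n[OF ij(1), of p] \<psi>n[OF ij(1), of q] eb by auto
      moreover have "n \<in> {?\<psi> j p', ?\<psi> j q'} \<longleftrightarrow> g = p' \<or> g = q'"
        using \<psi>n[OF ij(2), of p'] \<psi>n[OF ij(2), of q'] eb by auto
      ultimately have gg: "g = p \<or> g = q \<longleftrightarrow> g = p' \<or> g = q'" using eq by simp
      show False
      proof (cases "g = p \<or> g = q")
        case True
        define a where "a = (if g = p then q else p)"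
        define b where "b = (if g = p' then q' else p')"
        have pq: "{p, q} = {g, a}" "{p', q'} = {g, b}"
          using True gg unfolding a_def b_def by auto
        have a: "a \<noteq> g" "a < Suc n" "g \<le> a + 2" "a \<le> g + 2"
          and b: "b \<noteq> g" "b < Suc n" "g \<le> b + 2" "b \<le> g + 2"
          using True gg eb unfolding a_def b_def by auto
        have \<psi>g: "?\<psi> l g = n" for l by (simp add: \<psi>)
        have "?\<psi> i ` {p, q} = {n, ?\<psi> i a}" "?\<psi> j ` {p', q'} = {n, ?\<psi> j b}"
          unfolding pq image_insert image_empty \<psi>g by (rule refl)+
        then have "{n, ?\<psi> i a} = {n, ?\<psi> j b}" using eq by simp
        then have "?\<psi> i a = ?\<psi> j b" by (metis doubleton_eq_iff)
        then have "\<phi> i (r a) = \<phi> j (r b)" using a b by (simp add: \<psi>)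
        moreover have "g \<le> r a + 2" "r a < g + 2" "g \<le> r b + 2" "r b < g + 2"
          using a b unfolding r_def by auto
        ultimately show False
          using g ij r[OF a(2,1)] r[OF b(2,1)] unfolding free_gap_def by blast
      next
        case False
        \<comment> \<open>Removing \<open>g\<close> never increases a distance, so edges avoiding
          \<open>g\<close> remain edges.\<close>
        have "square_edge n (r p) (r q)" "square_edge n (r p') (r q')"
          using False gg eb gn unfolding square_edge_def r_def by auto
        then have "{\<phi> i (r p), \<phi> i (r q)} \<noteq> {\<phi> j (r p'), \<phi> j (r q')}"
          using \<phi> ij unfolding square_packing_def by blast
        moreover have "?\<psi> i p = \<phi> i (r p)" "?\<psi> i q = \<phi> i (r q)" "?\<psi> j p' = \<phi> j (r p')"
          "?\<psi> j q' = \<phi> j (r q')" using False gg by (auto simp: \<psi>)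
        ultimately show False using eq by simp
      qed
    qed
  qed
qed

text \<open>Gaps are filled from the largest down. As \<open>g + 2 \<le> h\<close>, the neighbours
  of gap \<open>g\<close> lie below \<open>h\<close>, where the insertion at \<open>h\<close>
  changes nothing, so \<open>g\<close> stays free.\<close>

lemma square_packing_insert_gaps:
  assumes "finite G" "square_packing k n \<phi>" "\<And>g. g \<in> G \<Longrightarrow> free_gap k n \<phi> g"
    and "\<And>g h. g \<in> G \<Longrightarrow> h \<in> G \<Longrightarrow> g < h \<Longrightarrow> g + 2 \<le> h"
  shows "\<exists>\<psi>. square_packing k (n + card G) \<psi>"
  using assms
proof (induction G arbitrary: n \<phi> rule: finite_linorder_max_induct)
  case empty
  then show ?case by auto
next
  case (insert h G)
  let ?\<psi> = "insert_fixed h n \<phi>"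
  have h: "free_gap k n \<phi> h" using insert.prems(2) by simp
  have "free_gap k (Suc n) ?\<psi> g" if "g \<in> G" for g
  proof -
    have gh: "g + 2 \<le> h" using that insert.hyps(2) insert.prems(3) by auto
    have g: "free_gap k n \<phi> g" using that insert.prems(2) by simp
    have near: "p < n" "?\<psi> i p = \<phi> i p" if "p < g + 2" for i p
      using that gh h unfolding free_gap_def insert_fixed_def by auto
    show ?thesis
      unfolding free_gap_def
    proof (intro conjI allI impI)
      show "g \<le> Suc n" using g unfolding free_gap_def by simp
    next
      fix i j p q
      assume "i < k" "j < k" "i \<noteq> j" "g \<le> p + 2" "p < g + 2" "g \<le> q + 2" "q < g + 2"
      then show "?\<psi> i p \<noteq> ?\<psi> j q"
        using g near unfolding free_gap_def by simp
    qed
  qed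
  note free = this
  have "\<exists>\<psi>. square_packing k (Suc n + card G) \<psi>"
  proof (rule insert.IH)
    show "square_packing k (Suc n) ?\<psi>"
      by (rule square_packing_insert_fixed[OF insert.prems(1) h])
    show "free_gap k (Suc n) ?\<psi> g" if "g \<in> G" for g by (rule free[OF that])
    show "g + 2 \<le> g'" if "g \<in> G" "g' \<in> G" "g < g'" for g g'
      using that by (intro insert.prems(3)) simp_all
  qed
  moreover have "h \<notin> G" using insert.hyps(2) by auto
  ultimately show ?case using insert.hyps(1) by simp
qed

corollary square_packing_add:
  assumes "finite G" "square_packing k n \<phi>" "\<And>g. g \<in> G \<Longrightarrow> free_gap k n \<phi> g"
    and "\<And>g h. g \<in> G \<Longrightarrow> h \<in> G \<Longrightarrow> g < h \<Longrightarrow> g + 2 \<le> h"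
    and "t \<le> card G"
  shows "\<exists>\<psi>. square_packing k (n + t) \<psi>"
proof -
  obtain S where S: "S \<subseteq> G" "card S = t" "finite S"
    using obtain_subset_with_card_n[OF assms(5)] by blast
  show ?thesis
    using square_packing_insert_gaps[OF S(3) assms(2)] assms(3,4) S(1,2) by blast
qed

section \<open>Rotating the columns of a grid\<close>

text \<open>Such an \<open>x\<close> has no prime factors except 2 and 3. It will be a column
  coefficient of \<open>block_shift\<close> or a difference of two of them.\<close>

lemma coprime_six_small:
  fixes m x :: int
  assumes "coprime m 6" "x \<noteq> 0" "\<bar>x\<bar> \<le> 4"
  shows "coprime m x"
proof -
  have "coprime m (2 * 3)" using assms(1) by simp
  then have c: "coprime m 2" "coprime m 3" by (simp_all only: coprime_mult_right_iff)
  then have "coprime m (2 * 2)" by (simp only: coprime_mult_right_iff)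
  then have "coprime m 4" by simp
  have "\<bar>x\<bar> = 1 \<or> \<bar>x\<bar> = 2 \<or> \<bar>x\<bar> = 3 \<or> \<bar>x\<bar> = 4" using assms by linarith
  with c \<open>coprime m 4\<close> have "coprime m \<bar>x\<bar>" by (metis coprime_1_right)
  then show ?thesis by simp
qed

lemma dvd_diff_imp_eq:
  assumes "int m dvd int i - int j" "i < m" "j < m"
  shows "i = j"
  using assms by (metis int_int_eq mod_eq_dvd_iff of_nat_less_iff mod_pos_pos_trivial of_nat_0_le_iff)

lemma nat_mod_eqD:
  assumes "nat (x mod int m) = nat (y mod int m)" "0 < m"
  shows "int m dvd x - y"
  using assms by (simp add: eq_nat_nat_iff mod_eq_dvd_iff)

lemma near_mod_5:
  fixes p q :: nat
  assumes "p mod 5 = q mod 5" "p \<le> q + 4" "q \<le> p + 4"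
  shows "p = q"
proof -
  have *: "a = b" if "a mod 5 = b mod 5" "a \<le> b" "b \<le> a + 4" for a b :: nat
  proof -
    have "5 dvd b - a" using that mod_eq_dvd_iff_nat[of a b 5] by simp
    then show ?thesis using that nat_dvd_not_less[of "b - a" 5] by linarith
  qed
  show ?thesis using *[of p q] *[of q p] assms by linarith
qed

text \<open>Why rows have length five: the steps 1, 2, -1, -2 are nonzero and distinct modulo 5, so
  the columns of the two ends of an edge determine its direction and its length.\<close>

lemma steps_mod_5:
  fixes p q p' q' :: nat
  assumes "p < q" "q \<le> p + 2" "p' < q'" "q' \<le> p' + 2"
  shows "p mod 5 = p' mod 5 \<Longrightarrow> q mod 5 = q' mod 5 \<Longrightarrow>
      int (p div 5) - int (p' div 5) = int (q div 5) - int (q' div 5)"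
    and "p mod 5 = q' mod 5 \<Longrightarrow> q mod 5 \<noteq> p' mod 5"
    and "p mod 5 \<noteq> q mod 5"
proof -
  show "int (p div 5) - int (p' div 5) = int (q div 5) - int (q' div 5)"
    if "p mod 5 = p' mod 5" "q mod 5 = q' mod 5"
  proof -
    have "q + p' = q' + p"
      by (rule near_mod_5[OF mod_add_cong]) (use that assms in auto)
    then show ?thesis
      using that div_mult_mod_eq[of p 5] div_mult_mod_eq[of p' 5]
        div_mult_mod_eq[of q 5] div_mult_mod_eq[of q' 5] by linarith
  qed
  show "q mod 5 \<noteq> p' mod 5" if "p mod 5 = q' mod 5"
  proof
    assume "q mod 5 = p' mod 5"
    then have "p + p' = q' + q"
      by (intro near_mod_5[OF mod_add_cong]) (use that assms in auto)
    then show False using assms by simp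
  qed
  show "p mod 5 \<noteq> q mod 5"
    using near_mod_5[of p q] assms by linarith
qed

text \<open>Position \<open>p\<close> is row \<open>p div 5\<close>, column \<open>p mod 5\<close>
  of the grid. Subtracting 2 puts the coefficient 0 in the middle column, away from the row
  boundaries where vertices are inserted.\<close>

definition block_shift :: "nat \<Rightarrow> nat \<Rightarrow> nat \<Rightarrow> nat" where
  "block_shift m i p = 5 * nat ((int (p div 5) + (int (p mod 5) - 2) * int i) mod int m) + p mod 5"

lemma block_shift_eqD:
  assumes "block_shift m i p = block_shift m j q" "0 < m"
  shows "p mod 5 = q mod 5"
    and "int m dvd int (p div 5) - int (q div 5) + (int (p mod 5) - 2) * (int i - int j)"
proof -
  have "block_shift m i p mod 5 = p mod 5" "block_shift m j q mod 5 = q mod 5"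
    unfolding block_shift_def by simp_all
  then show *: "p mod 5 = q mod 5" using assms by simp
  have "block_shift m i p div 5 = block_shift m j q div 5" using assms by simp
  then have "nat ((int (p div 5) + (int (p mod 5) - 2) * int i) mod int m)
      = nat ((int (q div 5) + (int (q mod 5) - 2) * int j) mod int m)"
    unfolding block_shift_def by simp
  from nat_mod_eqD[OF this assms(2)]
  show "int m dvd int (p div 5) - int (q div 5) + (int (p mod 5) - 2) * (int i - int j)"
    unfolding * by (simp add: algebra_simps)
qed

lemma square_packing_block_shift:
  assumes m: "coprime m 6"
  shows "square_packing m (5 * m) (block_shift m)"
proof -
  have m0: "0 < m" using m by (cases m) auto
  have mi: "coprime (int m) 6" using m by (metis coprime_int_iff of_nat_numeral)
  show ?thesis
    unfolding square_packing_def
  proof (intro conjI allI impI)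
    fix i assume i: "i < m"
    show "bij_betw (block_shift m i) {..<5 * m} {..<5 * m}"
    proof (rule bij_betw_lessThanI)
      show "inj_on (block_shift m i) {..<5 * m}"
      proof (rule inj_onI)
        fix p q assume pq: "p \<in> {..<5 * m}" "q \<in> {..<5 * m}" "block_shift m i p = block_shift m i q"
        have "p div 5 = q div 5"
          using block_shift_eqD(2)[OF pq(3) m0] pq(1,2) by (intro dvd_diff_imp_eq[of m]) auto
        then show "p = q" using block_shift_eqD(1)[OF pq(3) m0] by (metis div_mult_mod_eq)
      qed
      fix p assume "p < 5 * m"
      have "nat ((int (p div 5) + (int (p mod 5) - 2) * int i) mod int m) < m"
        using m0 by (simp add: nat_less_iff)
      then show "block_shift m i p < 5 * m"
        unfolding block_shift_def using mod_less_divisor[of 5 p] by linarith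
    qed
  next
    fix i j p q p' q'
    assume ij: "i < m" "j < m" "i \<noteq> j"
      and e: "square_edge (5 * m) p q" "square_edge (5 * m) p' q'"
    note eb = e[unfolded square_edge_def]
    show "{block_shift m i p, block_shift m i q} \<noteq> {block_shift m j p', block_shift m j q'}"
    proof
      assume "{block_shift m i p, block_shift m i q} = {block_shift m j p', block_shift m j q'}"
      then consider "block_shift m i p = block_shift m j p'" "block_shift m i q = block_shift m j q'"
        | "block_shift m i p = block_shift m j q'" "block_shift m i q = block_shift m j p'"
        by (metis doubleton_eq_iff)
      then show False
      proof cases
        case 1
        note p = block_shift_eqD[OF 1(1) m0] and q = block_shift_eqD[OF 1(2) m0]
        \<comment> \<open>The row differences at both ends agree, so subtracting the two congruences
          leaves the column difference times \<open>i - j\<close>.\<close>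
        have eq: "int (p div 5) - int (p' div 5) = int (q div 5) - int (q' div 5)"
          using steps_mod_5(1) p(1) q(1) eb by blast
        then have "int m dvd (int (p mod 5) - int (q mod 5)) * (int i - int j)"
          using dvd_diff[OF p(2)[unfolded eq] q(2)] by (simp add: algebra_simps)
        moreover have "p mod 5 \<noteq> q mod 5" using steps_mod_5(3) eb by blast
        then have "coprime (int m) (int (p mod 5) - int (q mod 5))"
          using mod_less_divisor[of 5 p] mod_less_divisor[of 5 q]
          by (intro coprime_six_small[OF mi]) linarith+
        ultimately have "int m dvd int i - int j" by (simp add: coprime_dvd_mult_right_iff)
        then show False using dvd_diff_imp_eq ij by blast
      next
        case 2
        have "p mod 5 = q' mod 5" "q mod 5 = p' mod 5"
          using block_shift_eqD(1)[OF 2(1) m0] block_shift_eqD(1)[OF 2(2) m0] .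
        then show False using steps_mod_5(2) eb by blast
      qed
    qed
  qed
qed

text \<open>The positions around a row boundary lie in columns 3, 4, 0, 1, whose coefficients 1, 2,
  -2, -1 are units modulo \<open>m\<close>.\<close>

lemma free_gap_block_shift:
  assumes m: "coprime m 6" and r: "r \<le> m"
  shows "free_gap m (5 * m) (block_shift m) (5 * r)"
proof -
  have m0: "0 < m" using m by (cases m) auto
  have mi: "coprime (int m) 6" using m by (metis coprime_int_iff of_nat_numeral)
  show ?thesis
    unfolding free_gap_def
  proof (intro conjI allI impI notI)
    show "5 * r \<le> 5 * m" using r by simp
  next
    fix i j p q
    assume ij: "i < m" "j < m" "i \<noteq> j"
      and b: "5 * r \<le> p + 2" "p < 5 * r + 2" "5 * r \<le> q + 2" "q < 5 * r + 2"
      and eq: "block_shift m i p = block_shift m j q"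
    have "p = q" by (rule near_mod_5[OF block_shift_eqD(1)[OF eq m0]]) (use b in auto)
    then have "int m dvd (int (p mod 5) - 2) * (int i - int j)"
      using block_shift_eqD(2)[OF eq m0] by simp
    moreover have "p mod 5 \<noteq> 2"
    proof
      assume "p mod 5 = 2"
      then have "(p + 3) mod 5 = (5 * r) mod 5" using mod_add_left_eq[of p 5 3] by simp
      then have "p + 3 = 5 * r" by (rule near_mod_5) (use b in auto)
      then show False using b by simp
    qed
    then have "coprime (int m) (int (p mod 5) - 2)"
      using mod_less_divisor[of 5 p] by (intro coprime_six_small[OF mi]) linarith+
    ultimately have "int m dvd int i - int j" by (simp add: coprime_dvd_mult_right_iff)
    then show False using dvd_diff_imp_eq ij by blast
  qed
qed

lemma square_packing_blocks:
  assumes m: "coprime m 6" and n: "5 * m \<le> n" "n \<le> 6 * m + 1"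
  shows "\<exists>\<phi>. square_packing m n \<phi>"
proof -
  \<comment> \<open>The \<open>m + 1\<close> row boundaries, both ends of the grid included, account
    for the upper bound \<open>6 * m + 1\<close>.\<close>
  let ?G = "(*) 5 ` {..m}"
  have "card ?G = Suc m" by (subst card_image) (auto simp: inj_on_def)
  then have "n - 5 * m \<le> card ?G" using n by simp
  then have "\<exists>\<phi>. square_packing m (5 * m + (n - 5 * m)) \<phi>"
    by (intro square_packing_add[OF _ square_packing_block_shift[OF m]])
      (auto intro: free_gap_block_shift[OF m])
  then show ?thesis using n by simp
qed

section \<open>Affine packings\<close>

text \<open>The first part makes the copies with multipliers \<open>a\<close> and \<open>b\<close> disjoint. The second part is for
inserting a vertex before the first position: with offset 3 its neighbours are mapped to \<open>3 a\<close>
and \<open>4 a\<close>, whereas those of a vertex appended at the end are mapped to \<open>a\<close> and \<open>2 a\<close>.\<close>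

definition separated :: "int \<Rightarrow> int \<Rightarrow> int \<Rightarrow> bool" where
  "separated N a b \<longleftrightarrow>
     (\<forall>x\<in>{a, 2 * a}. \<forall>y\<in>{b, 2 * b}. \<not> N dvd x - y \<and> \<not> N dvd x + y) \<and>
     (\<forall>x\<in>{3 * a, 4 * a}. \<forall>y\<in>{3 * b, 4 * b}. \<not> N dvd x - y)"

lemma separated_sym: "separated N a b \<Longrightarrow> separated N b a"
  unfolding separated_def by (metis add.commute dvd_diff_commute)

lemma separated_steps:
  assumes "separated N a b" "s \<in> {1, 2}" "t \<in> {1, 2}"
  shows "\<not> N dvd a * s - b * t" "\<not> N dvd a * s + b * t"
  using assms unfolding separated_def by (auto simp: mult.commute)

text \<open>Subtracting the congruences of the two ends cancels the offset \<open>c\<close> and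
  leaves \<open>a * s - b * t\<close> or \<open>a * s + b * t\<close> with steps \<open>s\<close>,
  \<open>t\<close> in \<open>{1, 2}\<close>.\<close>

lemma separated_edges:
  fixes c :: int
  assumes sep: "separated N a b" and e: "square_edge n p q" "square_edge n p' q'"
  shows "\<not> (N dvd a * (int p + c) - b * (int p' + c) \<and> N dvd a * (int q + c) - b * (int q' + c))"
    and "\<not> (N dvd a * (int p + c) - b * (int q' + c) \<and> N dvd a * (int q + c) - b * (int p' + c))"
proof -
  have st: "int q - int p \<in> {1, 2}" "int q' - int p' \<in> {1, 2}"
    using e unfolding square_edge_def by auto
  note sep = separated_steps[OF sep st]
  show "\<not> (N dvd a * (int p + c) - b * (int p' + c) \<and> N dvd a * (int q + c) - b * (int q' + c))"
  proof
    assume "N dvd a * (int p + c) - b * (int p' + c) \<and> N dvd a * (int q + c) - b * (int q' + c)"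
    then have "N dvd (a * (int q + c) - b * (int q' + c)) - (a * (int p + c) - b * (int p' + c))"
      by (meson dvd_diff)
    also have "\<dots> = a * (int q - int p) - b * (int q' - int p')" by (simp add: algebra_simps)
    finally show False using sep by simp
  qed
  show "\<not> (N dvd a * (int p + c) - b * (int q' + c) \<and> N dvd a * (int q + c) - b * (int p' + c))"
  proof
    assume "N dvd a * (int p + c) - b * (int q' + c) \<and> N dvd a * (int q + c) - b * (int p' + c)"
    then have "N dvd (a * (int q + c) - b * (int p' + c)) - (a * (int p + c) - b * (int q' + c))"
      by (meson dvd_diff)
    also have "\<dots> = a * (int q - int p) + b * (int q' - int p')" by (simp add: algebra_simps)
    finally show False using sep by simp
  qed
qed

text \<open>Stated for any \<open>\<phi>\<close> that determines residues, to serve both the maps on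
  all residues and those on the nonzero ones.\<close>

lemma square_packing_of_separated:
  fixes c :: int
  assumes cop: "\<And>a. a \<in> set as \<Longrightarrow> coprime a (int N)" and sep: "sorted_wrt (separated (int N)) as"
    and nN: "n \<le> N"
    and eqD: "\<And>i j p q. i < length as \<Longrightarrow> j < length as \<Longrightarrow> p < n \<Longrightarrow> q < n \<Longrightarrow> \<phi> i p = \<phi> j q \<Longrightarrow>
      int N dvd as ! i * (int p + c) - as ! j * (int q + c)"
    and less: "\<And>i p. i < length as \<Longrightarrow> p < n \<Longrightarrow> \<phi> i p < n"
  shows "square_packing (length as) n \<phi>"
  unfolding square_packing_def
proof (intro conjI allI impI)
  fix i assume i: "i < length as"
  show "bij_betw (\<phi> i) {..<n} {..<n}"
  proof (rule bij_betw_lessThanI)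
    show "inj_on (\<phi> i) {..<n}"
    proof (rule inj_onI)
      fix p q assume pq: "p \<in> {..<n}" "q \<in> {..<n}" "\<phi> i p = \<phi> i q"
      then have "int N dvd as ! i * (int p + c) - as ! i * (int q + c)"
        by (intro eqD i) auto
      also have "\<dots> = as ! i * (int p - int q)" by (simp add: algebra_simps)
      finally have "int N dvd int p - int q"
        using cop[OF nth_mem[OF i]] by (simp add: coprime_dvd_mult_right_iff coprime_commute)
      then show "p = q" using pq nN by (intro dvd_diff_imp_eq[of N]) auto
    qed
  qed (rule less[OF i])
next
  fix i j p q p' q'
  assume ij: "i < length as" "j < length as" "i \<noteq> j"
    and e: "square_edge n p q" "square_edge n p' q'"
  have "separated (int N) (as ! i) (as ! j)"
    using sep ij by (cases i j rule: linorder_cases)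
      (auto simp: sorted_wrt_iff_nth_less intro: separated_sym)
  note s = separated_edges[OF this e, of c]
  have b: "p < n" "q < n" "p' < n" "q' < n" using e unfolding square_edge_def by auto
  show "{\<phi> i p, \<phi> i q} \<noteq> {\<phi> j p', \<phi> j q'}"
    using s eqD[OF ij(1,2) b(1,3)] eqD[OF ij(1,2) b(2,4)] eqD[OF ij(1,2) b(1,4)]
      eqD[OF ij(1,2) b(2,3)] unfolding doubleton_eq_iff by blast
qed

text \<open>The affine maps settle order \<open>N\<close>; the gaps before the first and after the
  last position take up to two fixed vertices.\<close>

lemma square_packing_affine:
  assumes N: "2 \<le> N" and cop: "\<And>a. a \<in> set as \<Longrightarrow> coprime a (int N)"
    and sep: "sorted_wrt (separated (int N)) as" and t: "t \<le> 2"
  shows "\<exists>\<phi>. square_packing (length as) (N + t) \<phi>"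
proof -
  define \<phi> where "\<phi> i p = nat (as ! i * (int p + 3) mod int N)" for i p
  have eqD: "int N dvd as ! i * (int p + 3) - as ! j * (int q + 3)" if "\<phi> i p = \<phi> j q" for i j p q
    using that N unfolding \<phi>_def by (intro nat_mod_eqD) auto
  have sp: "square_packing (length as) N \<phi>"
  proof (rule square_packing_of_separated[OF cop sep])
    show "\<phi> i p < N" for i p unfolding \<phi>_def using N by (simp add: nat_less_iff)
  qed (use eqD in auto)
  have sepij: "separated (int N) (as ! i) (as ! j)" if "i < length as" "j < length as" "i \<noteq> j" for i j
    using sep that by (cases i j rule: linorder_cases)
      (auto simp: sorted_wrt_iff_nth_less intro: separated_sym)
  have gap0: "free_gap (length as) N \<phi> 0"
    unfolding free_gap_def
  proof (intro conjI allI impI notI)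
    fix i j p q
    assume ij: "i < length as" "j < length as" "i \<noteq> j" and pq: "p < 0 + 2" "q < 0 + 2"
      and eq: "\<phi> i p = \<phi> j q"
    have "p = 0 \<or> p = 1" "q = 0 \<or> q = 1" using pq by auto
    then show False
      using eqD[OF eq] sepij[OF ij] unfolding separated_def by (auto simp: mult.commute)
  qed simp
  have gapN: "free_gap (length as) N \<phi> N"
    unfolding free_gap_def
  proof (intro conjI allI impI notI)
    fix i j p q
    assume ij: "i < length as" "j < length as" "i \<noteq> j" and pq: "p < N" "q < N" "N \<le> p + 2" "N \<le> q + 2"
      and eq: "\<phi> i p = \<phi> j q"
    \<comment> \<open>Modulo \<open>N\<close> the last two positions are sent to \<open>a\<close>
      and \<open>2 * a\<close>.\<close>
    have "int p + 3 - int N \<in> {1, 2}" "int q + 3 - int N \<in> {1, 2}" using pq by auto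
    from separated_steps(1)[OF sepij[OF ij] this]
    have "\<not> int N dvd as ! i * (int p + 3) - as ! j * (int q + 3) - int N * (as ! i - as ! j)"
      by (simp add: algebra_simps)
    then show False using eqD[OF eq] by (simp add: dvd_diff)
  qed simp
  show ?thesis
    by (rule square_packing_add[of "{0, N}", OF _ sp]) (use N t gap0 gapN in auto)
qed

lemma square_packing_affine_delete:
  assumes cop: "\<And>a. a \<in> set as \<Longrightarrow> coprime a (int (Suc n))"
    and sep: "sorted_wrt (separated (int (Suc n))) as"
  shows "\<exists>\<phi>. square_packing (length as) n \<phi>"
proof -
  define \<psi> where "\<psi> i p = as ! i * (int p + 1) mod int (Suc n)" for i p
  define \<phi> where "\<phi> i p = nat (\<psi> i p - 1)" for i p
  have \<psi>: "0 < \<psi> i p" "\<psi> i p \<le> int n" if "i < length as" "p < n" for i p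
  proof -
    have "\<not> int (Suc n) dvd as ! i * (int p + 1)"
    proof
      assume "int (Suc n) dvd as ! i * (int p + 1)"
      then have "int (Suc n) dvd int p + 1"
        using cop[OF nth_mem[OF that(1)]] by (simp add: coprime_dvd_mult_right_iff coprime_commute)
      then have "int (Suc n) \<le> int p + 1" by (intro zdvd_imp_le) auto
      then show False using that by simp
    qed
    then have "\<psi> i p \<noteq> 0" unfolding \<psi>_def by (simp add: dvd_eq_mod_eq_0)
    moreover have "0 \<le> \<psi> i p" "\<psi> i p < int (Suc n)"
      unfolding \<psi>_def by (rule pos_mod_sign pos_mod_bound; simp)+
    ultimately show "0 < \<psi> i p" "\<psi> i p \<le> int n" by auto
  qed
  have "square_packing (length as) n \<phi>"
  proof (rule square_packing_of_separated[OF cop sep])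
    fix i j p q
    assume b: "i < length as" "j < length as" "p < n" "q < n" and "\<phi> i p = \<phi> j q"
    \<comment> \<open>Positivity matters: \<open>nat\<close> would identify the lowered values of 0
      and 1.\<close>
    then have "\<psi> i p = \<psi> j q"
      using \<psi>(1)[OF b(1,3)] \<psi>(1)[OF b(2,4)] unfolding \<phi>_def by simp
    then show "int (Suc n) dvd as ! i * (int p + 1) - as ! j * (int q + 1)"
      unfolding \<psi>_def mod_eq_dvd_iff .
  next
    fix i p assume "i < length as" "p < n"
    from \<psi>[OF this] show "\<phi> i p < n" unfolding \<phi>_def by auto
  qed auto
  then show ?thesis by blast
qed

section \<open>Parameters for every order \<open>n \<ge> 9\<close>\<close>

definition separated_units :: "nat \<Rightarrow> int list \<Rightarrow> bool" where
  "separated_units N as \<longleftrightarrow>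
     (\<forall>a\<in>set as. coprime a (int N)) \<and> sorted_wrt (separated (int N)) as"

text \<open>One modulus serves four orders: one residue deleted, or none, one or two vertices
  inserted.\<close>

lemma square_packing_near:
  assumes "2 \<le> N" "separated_units N as"
    and "N \<le> n + 1" "n \<le> N + 2"
  shows "\<exists>\<phi>. square_packing (length as) n \<phi>"
proof (cases "N \<le> n")
  case True
  then show ?thesis
    using square_packing_affine[of N as "n - N"] assms unfolding separated_units_def by auto
next
  case False
  then have "N = Suc n" using assms by simp
  then show ?thesis using square_packing_affine_delete[of as n] assms unfolding separated_units_def by simp
qed

text \<open>The multipliers in the following proof were found by computer search.\<close>

lemma square_packing_table:
  assumes "6 * k \<le> n + 4"
    and "n \<in> {9..24} \<or> n \<in> {32..34} \<or> n \<in> {44..54} \<or> n \<in> {80..84}"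
  shows "\<exists>l\<ge>k. \<exists>\<phi>. square_packing l n \<phi>"
proof -
  \<comment> \<open>Together with \<open>6 * k \<le> n + 4\<close> the last bound gives
    \<open>6 * k < 6 * length as + 6\<close>.\<close>
  have *: ?thesis
    if "separated_units N as" "2 \<le> N"
      "N \<le> n + 1" "n \<le> N + 2" "n < 6 * length as + 2" for N as
  proof -
    have "k \<le> length as" using assms(1) that(5) by linarith
    with square_packing_near[OF that(2,1,3,4)] show ?thesis by blast
  qed
  from assms(2)
  consider "n \<in> {9..11}" | "n \<in> {12..15}" | "n \<in> {16..19}" | "n \<in> {20..21}" | "n \<in> {22..24}"
    | "n \<in> {32..33}" | "n = 34" | "n \<in> {44..45}" | "n \<in> {46..49}" | "n \<in> {50..51}"
    | "n \<in> {52..54}" | "n \<in> {80..81}" | "n \<in> {82..84}"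
  proof (elim disjE)
    assume "n \<in> {9..24}"
    then have "n \<in> {9..11} \<or> n \<in> {12..15} \<or> n \<in> {16..19} \<or> n \<in> {20..21} \<or> n \<in> {22..24}"
      unfolding atLeastAtMost_iff by linarith
    with that show thesis by blast
  next
    assume "n \<in> {32..34}"
    then have "n \<in> {32..33} \<or> n = 34" by auto
    with that show thesis by blast
  next
    assume "n \<in> {44..54}"
    then have "n \<in> {44..45} \<or> n \<in> {46..49} \<or> n \<in> {50..51} \<or> n \<in> {52..54}"
      unfolding atLeastAtMost_iff by linarith
    with that show thesis by blast
  next
    assume "n \<in> {80..84}"
    then have "n \<in> {80..81} \<or> n \<in> {82..84}" by auto
    with that show thesis by blast
  qed
  then show ?thesis
  proof cases
    case 1
    have "separated_units 10 [1, 3]" by code_simp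
    from *[OF this] 1 show ?thesis by simp
  next
    case 2
    have "separated_units 13 [1, 3, 9]" by code_simp
    from *[OF this] 2 show ?thesis by simp
  next
    case 3
    have "separated_units 17 [1, 3, 12]" by code_simp
    from *[OF this] 3 show ?thesis by simp
  next
    case 4
    have "separated_units 19 [1, 4, 5, 6]" by code_simp
    from *[OF this] 4 show ?thesis by simp
  next
    case 5
    have "separated_units 23 [1, 3, 5, 7]" by code_simp
    from *[OF this] 5 show ?thesis by simp
  next
    case 6
    have "separated_units 31 [1, 3, 5, 7, 8, 9]" by code_simp
    from *[OF this] 6 show ?thesis by simp
  next
    case 7
    have "separated_units 35 [1, 4, 6, 9, 11, 16]" by code_simp
    from *[OF this] 7 show ?thesis by simp
  next
    case 8
    have "separated_units 43 [1, 3, 5, 7, 8, 9, 11, 15]" by code_simp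
    from *[OF this] 8 show ?thesis by simp
  next
    case 9
    have "separated_units 47 [1, 3, 5, 7, 8, 9, 11, 13]" by code_simp
    from *[OF this] 9 show ?thesis by simp
  next
    case 10
    have "separated_units 49 [1, 3, 5, 8, 9, 11, 15, 36, 37]" by code_simp
    from *[OF this] 10 show ?thesis by simp
  next
    case 11
    have "separated_units 53 [1, 3, 5, 7, 8, 9, 11, 13, 15]" by code_simp
    from *[OF this] 11 show ?thesis by simp
  next
    case 12
    have "separated_units 79 [1, 3, 5, 7, 8, 9, 11, 13, 15, 17, 19, 21, 23, 24]" by code_simp
    from *[OF this] 12 show ?thesis by simp
  next
    case 13
    have "separated_units 83 [1, 3, 5, 7, 8, 9, 11, 13, 15, 17, 19, 21, 24, 25]" by code_simp
    from *[OF this] 13 show ?thesis by simp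
  qed
qed

lemma ex_coprime_six_near:
  fixes n :: nat
  assumes "n \<in> {25..31} \<or> n \<in> {35..43} \<or> n \<in> {55..79} \<or> 85 \<le> n"
  shows "\<exists>m. coprime m 6 \<and> 5 * m \<le> n \<and> n \<le> 6 * m + 1"
\<comment> \<open>From 110 on, \<open>6 * c \<le> n + 4\<close> implies
  \<open>5 * (c + 3) \<le> n\<close>; below, the values 5, 7, 11, 13, 17, 19 of \<open>m\<close>
  suffice.\<close>
proof (cases "n < 110")
  case True
  with assms consider "n \<in> {25..31}" | "n \<in> {35..43}" | "n \<in> {55..67}" | "n \<in> {68..79}"
    | "n \<in> {85..103}" | "n \<in> {104..109}"
    unfolding atLeastAtMost_iff by arith
  then show ?thesis
  proof cases
    case 1 then show ?thesis by (intro exI[of _ 5]) (auto simp: coprime_iff_gcd_eq_1 gcd_non_0_nat)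
  next
    case 2 then show ?thesis by (intro exI[of _ 7]) (auto simp: coprime_iff_gcd_eq_1 gcd_non_0_nat)
  next
    case 3 then show ?thesis by (intro exI[of _ 11]) (auto simp: coprime_iff_gcd_eq_1 gcd_non_0_nat)
  next
    case 4 then show ?thesis by (intro exI[of _ 13]) (auto simp: coprime_iff_gcd_eq_1 gcd_non_0_nat)
  next
    case 5 then show ?thesis by (intro exI[of _ 17]) (auto simp: coprime_iff_gcd_eq_1 gcd_non_0_nat)
  next
    case 6 then show ?thesis by (intro exI[of _ 19]) (auto simp: coprime_iff_gcd_eq_1 gcd_non_0_nat)
  qed
next
  case False
  \<comment> \<open>The least \<open>m\<close> with \<open>n \<le> 6 * m + 1\<close>. From any
    residue modulo 6 at most three steps up lead to 1 or 5; the worst case is residue 2.\<close>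
  define c where "c = (n + 4) div 6"
  have c: "6 * c \<le> n + 4" "n + 4 < 6 * c + 6"
    unfolding c_def using div_mult_mod_eq[of "n + 4" 6] mod_less_divisor[of 6 "n + 4"] by linarith+
  have cop: "coprime m 6" if "m mod 6 = 1 \<or> m mod 6 = 5" for m :: nat
  proof -
    have "gcd m 6 = gcd 6 (m mod 6)" by (metis gcd.commute gcd_red_nat)
    moreover have "gcd 6 (5 :: nat) = 1" by (simp add: gcd_non_0_nat)
    ultimately have "gcd m 6 = 1" using that by (metis gcd_1_nat)
    then show ?thesis by (simp add: coprime_iff_gcd_eq_1)
  qed
  have "c mod 6 < 6" by simp
  then consider "c mod 6 = 0" | "c mod 6 = 1" | "c mod 6 = 2" | "c mod 6 = 3" | "c mod 6 = 4"
    | "c mod 6 = 5" by linarith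
  then have "\<exists>d\<le>3. (c + d) mod 6 = 1 \<or> (c + d) mod 6 = 5"
  proof cases
    case 1
    then have "(c + 1) mod 6 = 1" unfolding mod_add_left_eq[of c 6 1, symmetric] by simp
    then show ?thesis by (intro exI[of _ 1]) simp
  next
    case 2 then show ?thesis by (intro exI[of _ 0]) simp
  next
    case 3
    then have "(c + 3) mod 6 = 5" unfolding mod_add_left_eq[of c 6 3, symmetric] by simp
    then show ?thesis by (intro exI[of _ 3]) simp
  next
    case 4
    then have "(c + 2) mod 6 = 5" unfolding mod_add_left_eq[of c 6 2, symmetric] by simp
    then show ?thesis by (intro exI[of _ 2]) simp
  next
    case 5
    then have "(c + 1) mod 6 = 5" unfolding mod_add_left_eq[of c 6 1, symmetric] by simp
    then show ?thesis by (intro exI[of _ 1]) simp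
  next
    case 6 then show ?thesis by (intro exI[of _ 0]) simp
  qed
  then obtain d where "d \<le> 3" "coprime (c + d) 6" using cop by blast
  with c False show ?thesis by (intro exI[of _ "c + d"]) auto
qed

lemma ex_square_packing:
  assumes "6 * k \<le> n + 4" "9 \<le> n"
  shows "\<exists>l\<ge>k. \<exists>\<phi>. square_packing l n \<phi>"
proof (cases "n \<in> {25..31} \<or> n \<in> {35..43} \<or> n \<in> {55..79} \<or> 85 \<le> n")
  case True
  then obtain m where m: "coprime m 6" "5 * m \<le> n" "n \<le> 6 * m + 1"
    using ex_coprime_six_near by blast
  \<comment> \<open>\<open>6 * k \<le> n + 4 \<le> 6 * m + 5\<close>.\<close>
  moreover have "k \<le> m" using m(3) assms(1) by linarith
  ultimately show ?thesis using square_packing_blocks by blast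
next
  case False
  then have "n \<in> {9..24} \<or> n \<in> {32..34} \<or> n \<in> {44..54} \<or> n \<in> {80..84}"
    using assms(2) unfolding atLeastAtMost_iff by linarith
  with square_packing_table assms(1) show ?thesis by blast
qed

section \<open>Eight vertices\<close>

text \<open>Each of these two permutations maps only two edges of the square of the path to edges again
(see \<open>eight_conflicts\<close>), and a graph of maximum degree two cannot have a conflict for both.\<close>

definition eight_a :: "nat list" where "eight_a = [2, 6, 3, 0, 7, 4, 1, 5]"
definition eight_b :: "nat list" where "eight_b = [2, 5, 6, 1, 4, 7, 0, 3]"

lemma bij_betw_eight:
  assumes "xs \<in> {eight_a, eight_b}"
  shows "bij_betw ((!) xs) {..<8} {..<8}"
proof -
  have "distinct xs" "length xs = 8" using assms unfolding eight_a_def eight_b_def by auto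
  moreover have "set xs = {..<8}"
    using assms unfolding eight_a_def eight_b_def by (auto simp: lessThan_nat_numeral lessThan_Suc)
  ultimately show ?thesis using bij_betw_nth by (metis)
qed

lemma square_edge_eight:
  assumes "square_edge 8 p q"
  shows "(p, q) \<in> {(0,1),(0,2),(1,2),(1,3),(2,3),(2,4),(3,4),(3,5),(4,5),(4,6),(5,6),(5,7),(6,7)}"
proof -
  have q: "q = p + 1 \<or> q = p + 2" "q < 8" using assms unfolding square_edge_def by auto
  then have "p = 0 \<or> p = 1 \<or> p = 2 \<or> p = 3 \<or> p = 4 \<or> p = 5 \<or> p = 6" by linarith
  with q show ?thesis by (elim disjE) simp_all
qed

lemma eight_conflicts:
  assumes "square_edge 8 p q" "square_edge 8 p' q'"
  shows "{p, q} = {eight_a ! p', eight_a ! q'} \<Longrightarrow>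
      {p, q} = {2, 3} \<and> {p', q'} = {0, 2} \<or> {p, q} = {4, 5} \<and> {p', q'} = {5, 7}"
    and "{p, q} = {eight_b ! p', eight_b ! q'} \<Longrightarrow>
      {p, q} = {5, 6} \<and> {p', q'} = {1, 2} \<or> {p, q} = {4, 6} \<and> {p', q'} = {2, 4}"
proof -
  have pq: "p < q" "q \<le> p + 2" using assms(1) unfolding square_edge_def by auto
  \<comment> \<open>Only images at distance at most two can be edges again; checking the thirteen
    edges leaves two for each permutation.\<close>
  have far: False if "{p, q} = {x, y}" "x + 2 < y \<or> y + 2 < x" for x y
    using that pq unfolding doubleton_eq_iff by auto
  have a: "eight_a ! p' + 2 < eight_a ! q' \<or> eight_a ! q' + 2 < eight_a ! p'
    \<or> p' = 0 \<and> q' = 2 \<and> eight_a ! p' = 2 \<and> eight_a ! q' = 3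
    \<or> p' = 5 \<and> q' = 7 \<and> eight_a ! p' = 4 \<and> eight_a ! q' = 5"
    using square_edge_eight[OF assms(2)] unfolding eight_a_def by (elim insertE) simp_all
  show "{p, q} = {2, 3} \<and> {p', q'} = {0, 2} \<or> {p, q} = {4, 5} \<and> {p', q'} = {5, 7}"
    if "{p, q} = {eight_a ! p', eight_a ! q'}"
  proof -
    from far[OF that] a consider "p' = 0" "q' = 2" "eight_a ! p' = 2" "eight_a ! q' = 3"
      | "p' = 5" "q' = 7" "eight_a ! p' = 4" "eight_a ! q' = 5"
      by blast
    then show ?thesis using that by cases (simp_all only:, simp_all add: insert_commute)
  qed
  have b: "eight_b ! p' + 2 < eight_b ! q' \<or> eight_b ! q' + 2 < eight_b ! p'
    \<or> p' = 1 \<and> q' = 2 \<and> eight_b ! p' = 5 \<and> eight_b ! q' = 6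
    \<or> p' = 2 \<and> q' = 4 \<and> eight_b ! p' = 6 \<and> eight_b ! q' = 4"
    using square_edge_eight[OF assms(2)] unfolding eight_b_def by (elim insertE) simp_all
  show "{p, q} = {5, 6} \<and> {p', q'} = {1, 2} \<or> {p, q} = {4, 6} \<and> {p', q'} = {2, 4}"
    if "{p, q} = {eight_b ! p', eight_b ! q'}"
  proof -
    from far[OF that] b consider "p' = 1" "q' = 2" "eight_b ! p' = 5" "eight_b ! q' = 6"
      | "p' = 2" "q' = 4" "eight_b ! p' = 6" "eight_b ! q' = 4"
      by blast
    then show ?thesis using that by cases (simp_all only:, simp_all add: insert_commute)
  qed
qed

text \<open>The first copy is the layout itself, the second the layout followed by whichever
  permutation has no conflict with the laid-out edges \<open>F\<close>.\<close>

lemma placeable_eight: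
  assumes g: "simple_graph V E" and d: "\<And>v. v \<in> V \<Longrightarrow> degree E v \<le> 2" and c: "card V = 8"
  shows "placeable V E 2"
proof -
  obtain f :: "'a \<Rightarrow> nat" where f: "bij_betw f V {..<8}"
    and fE: "\<And>e. e \<in> E \<Longrightarrow> \<exists>u v. e = {u, v} \<and> u \<in> V \<and> v \<in> V \<and> f u < f v \<and> f v \<le> f u + 2"
    using graph_layout[OF g d] unfolding c by blast
  define F where "F = (`) f ` E"
  have fe: "\<exists>p q. X = {p, q} \<and> square_edge 8 p q" if "X \<in> F" for X
    using fE bij_betw_apply[OF f] that unfolding square_edge_def F_def by fastforce
  have finE: "finite E"
    using g unfolding simple_graph_def by (intro finite_subset[of E "Pow V"]) auto
  \<comment> \<open>The degree bound carried over to \<open>F\<close>: no position lies on three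
    distinct edges.\<close>
  have deg: False if t: "a \<in> F" "b \<in> F" "c \<in> F" "x \<in> a" "x \<in> b" "x \<in> c" "a \<noteq> b" "a \<noteq> c" "b \<noteq> c" for a b c x
  proof -
    obtain a' b' c' where E: "a' \<in> E" "b' \<in> E" "c' \<in> E" "a = f ` a'" "b = f ` b'" "c = f ` c'"
      using t(1-3) unfolding F_def by blast
    have sub: "a' \<subseteq> V" "b' \<subseteq> V" "c' \<subseteq> V" using g E unfolding simple_graph_def by auto
    obtain v where v: "v \<in> a'" "f v = x" using t(4) E by auto
    then have vV: "v \<in> V" using sub by auto
    have inj: "inj_on f V" using f bij_betw_def by blast
    have "v \<in> b'" "v \<in> c'"
      using t(5,6) E v vV sub inj by (metis inj_on_image_mem_iff)+
    then have "card {a', b', c'} \<le> degree E v"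
      unfolding degree_def using E v finE by (intro card_mono) auto
    moreover have "card {a', b', c'} = 3" using t(7-9) E by (auto simp: card_insert_if)
    ultimately show False using d[OF vV] by simp
  qed
  obtain xs where xs: "xs \<in> {eight_a, eight_b}"
    and disj: "\<And>X Y. X \<in> F \<Longrightarrow> Y \<in> F \<Longrightarrow> X \<noteq> (!) xs ` Y"
  proof (cases "\<exists>X\<in>F. \<exists>Y\<in>F. X = (!) eight_a ` Y")
    case False
    then show ?thesis using that[of eight_a] by blast
  next
    case a: True
    show ?thesis
    proof (cases "\<exists>X\<in>F. \<exists>Y\<in>F. X = (!) eight_b ` Y")
      case False
      then show ?thesis using that[of eight_b] by blast
    next
      case b: True
      have A: "{2, 3} \<in> F \<and> {0, 2} \<in> F \<or> {4, 5} \<in> F \<and> {5, 7} \<in> F"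
      proof -
        obtain X Y where XY: "X \<in> F" "Y \<in> F" "X = (!) eight_a ` Y" using a by blast
        obtain p q p' q' where "X = {p, q}" "square_edge 8 p q" "Y = {p', q'}" "square_edge 8 p' q'"
          using fe[OF XY(1)] fe[OF XY(2)] by blast
        with eight_conflicts(1)[of p q p' q'] XY show ?thesis by auto
      qed
      have B: "{5, 6} \<in> F \<and> {1, 2} \<in> F \<or> {4, 6} \<in> F \<and> {2, 4} \<in> F"
      proof -
        obtain X Y where XY: "X \<in> F" "Y \<in> F" "X = (!) eight_b ` Y" using b by blast
        obtain p q p' q' where "X = {p, q}" "square_edge 8 p q" "Y = {p', q'}" "square_edge 8 p' q'"
          using fe[OF XY(1)] fe[OF XY(2)] by blast
        with eight_conflicts(2)[of p q p' q'] XY show ?thesis by auto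
      qed
      \<comment> \<open>In each of the four combinations of conflicts, three of the edges meet: at 2
        if the first option of \<open>A\<close> holds, otherwise at 5 or 4.\<close>
      have False
        using A B deg[of "{2, 3}" "{0, 2}" "{1, 2}" 2] deg[of "{2, 3}" "{0, 2}" "{2, 4}" 2]
          deg[of "{4, 5}" "{5, 7}" "{5, 6}" 5] deg[of "{4, 5}" "{4, 6}" "{2, 4}" 4]
        by (auto simp: doubleton_eq_iff)
      then show ?thesis ..
    qed
  qed
  define \<phi> where "\<phi> i = (if i = (0::nat) then f else (!) xs \<circ> f)" for i
  have "placement V E 2 \<phi>"
    unfolding placement_def
  proof (intro conjI allI impI)
    fix i :: nat
    show "bij_betw (\<phi> i) V {0..<card V}"
      using f bij_betw_trans[OF f bij_betw_eight[OF xs]] c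
      unfolding \<phi>_def lessThan_atLeast0[symmetric] by simp
  next
    fix i j :: nat assume ij: "i < 2" "j < 2" "i \<noteq> j"
    have 0: "edge_image (\<phi> 0) E = F" unfolding \<phi>_def F_def edge_image_def by simp
    have 1: "edge_image (\<phi> 1) E = (`) ((!) xs) ` F"
      unfolding \<phi>_def F_def edge_image_def by (simp add: image_image image_comp)
    have "F \<inter> (`) ((!) xs) ` F = {}" using disj by blast
    moreover have "i = 0 \<and> j = 1 \<or> i = 1 \<and> j = 0" using ij by linarith
    ultimately show "edge_image (\<phi> i) E \<inter> edge_image (\<phi> j) E = {}" using 0 1 by (auto simp: Int_commute)
  qed
  then show ?thesis unfolding placeable_def by blast
qed

section \<open>The bound \<open>6 * k - 4\<close>, split into one copy, eight vertices and larger
  orders\<close>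

theorem theorem2p8:
  fixes V :: "'a set" and E :: "'a set set" and k :: nat
  assumes "k \<ge> 1"
    and "simple_graph V E"
    and "card V \<ge> 6 * k - 4"
    and "max_degree V E = 2"
  shows "placeable V E k"
proof -
  have deg: "degree E v \<le> 2" if "v \<in> V" for v
    using assms(2,4) that Max_ge[of "degree E ` V" "degree E v"]
    unfolding max_degree_def simple_graph_def by auto
  have k: "6 * k \<le> card V + 4" using assms(3) by linarith
  \<comment> \<open>For \<open>k \<ge> 2\<close> the bound gives at least
    \<open>6 * 2 - 4 = 8\<close> vertices.\<close>
  consider "k = 1" | "card V = 8" | "9 \<le> card V" using k assms(1) by linarith
  then show ?thesis
  proof cases
    case 1
    have "square_packing 1 (card V) (\<lambda>_ p. p)" unfolding square_packing_def by (auto simp: bij_betw_def)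
    with 1 show ?thesis using square_packing_placeable[OF assms(2) deg] by blast
  next
    case 2
    then have "k \<le> 2" using k by linarith
    with placeable_eight[OF assms(2) deg 2] show ?thesis by (rule placeable_mono)
  next
    case 3
    from ex_square_packing[OF k this] obtain l \<phi> where "k \<le> l" "square_packing l (card V) \<phi>" by blast
    with square_packing_placeable[OF assms(2) deg] show ?thesis by (blast intro: placeable_mono)
  qed
qed

end
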